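(* Let $X$ be a Hausdorff locally convex topological vector space, $e$ an error function on $X\times X$, $f,g:X\to\mathbb{R}\cup\{+\infty\}$ proper and $e$-convex functions, and $x_0\in\operatorname{dom} f\cap\operatorname{dom} g$. If $f-g$ attains its global minimum at $x_0$, then $\partial^e g(x_0)\subset\partial^e f(x_0)$.
   Context: $\operatorname{dom} f=\{x: f(x)<+\infty\}$; $f$ is proper if $\operatorname{dom} f\ne\emptyset$. An error function is a map $e:X\times X\to\mathbb{R}\cup\{+\infty\}$ that is nonnegative, symmetric, and has nonempty domain $\operatorname{dom} e=\{(x,y): e(x,y)<+\infty\}$. $f$ is $e$-convex if $\operatorname{dom} f\times\operatorname{dom} f\subset\operatorname{dom} e$ and $f(tx+(1-t)y)\le tf(x)+(1-t)f(y)+t(1-t)e(x,y)$ for all $x,y\in X$, $t\in\,]0,1[$. $\partial^e f(x)=\{x^*\in X^*:\langle y-x,x^*\rangle\le f(y)-f(x)+e(x,y)\ \forall y\in X\}$ for $x\in\operatorname{dom} f$, empty otherwise. Convention: $(+\infty)+(-\infty)=(-\infty)+(+\infty)=-\infty$ (so $(+\infty)-(+\infty)=-\infty$). *)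

theory Defs
  imports "HOL-Analysis.Analysis"
begin

class hausdorff_lctvs = real_vector + topological_ab_group_add + t2_space +
  assumes tendsto_scaleR_Pair:
    "LIM x (nhds (r::real) \<times>\<^sub>F nhds a). fst x *\<^sub>R snd x :> nhds (r *\<^sub>R a)"
  and convex_nhd_base_unfolded:
    (* convex V, unfolded: the constant cannot be used inside a class specification *)
    "open U \<Longrightarrow> 0 \<in> U \<Longrightarrow> \<exists>V. open V \<and> 0 \<in> V \<and> V \<subseteq> U \<and>
       (\<forall>x\<in>V. \<forall>y\<in>V. \<forall>u\<ge>0::real. \<forall>v\<ge>0. u + v = 1 \<longrightarrow> u *\<^sub>R x + v *\<^sub>R y \<in> V)"

lemma convex_nhd_base:
  fixes U :: "'a::hausdorff_lctvs set"
  assumes "open U" "0 \<in> U"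
  shows "\<exists>V. open V \<and> 0 \<in> V \<and> V \<subseteq> U \<and> convex V"
  using convex_nhd_base_unfolded[OF assms] by (simp only: convex_def)

instance real_normed_vector \<subseteq> hausdorff_lctvs
proof
  fix r :: real and a :: 'a
  show "LIM x (nhds r \<times>\<^sub>F nhds a). fst x *\<^sub>R snd x :> nhds (r *\<^sub>R a)"
    by (intro tendsto_scaleR filterlim_fst filterlim_snd)
next
  fix U :: "'a set"
  assume "open U" "0 \<in> U"
  then obtain d where "d > 0" "ball 0 d \<subseteq> U"
    by (auto simp: open_contains_ball)
  then have "open (ball 0 d) \<and> 0 \<in> ball 0 d \<and> ball 0 d \<subseteq> U \<and> convex (ball (0::'a) d)"
    by simp
  then show "\<exists>V. open V \<and> 0 \<in> V \<and> V \<subseteq> U \<and>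
      (\<forall>x\<in>V. \<forall>y\<in>V. \<forall>u\<ge>0::real. \<forall>v\<ge>0. u + v = 1 \<longrightarrow> u *\<^sub>R x + v *\<^sub>R y \<in> V)"
    unfolding convex_def by blast
qed

text \<open>
  The library sets \<open>\<infinity> + (-\<infinity>) = \<infinity>\<close> and \<open>\<infinity> - \<infinity> = \<infinity>\<close> on \<open>ereal\<close>. The convention needed here is
  the opposite one: indeterminate sums are \<open>-\<infinity>\<close>.
\<close>

definition lower_add :: "ereal \<Rightarrow> ereal \<Rightarrow> ereal"  (infixl "\<oplus>" 65) where
  "a \<oplus> b = (if a = -\<infinity> \<or> b = -\<infinity> then -\<infinity> else a + b)"

definition lower_minus :: "ereal \<Rightarrow> ereal \<Rightarrow> ereal"  (infixl "\<ominus>" 65) where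
  "a \<ominus> b = a \<oplus> (- b)"

definition edom :: "('a \<Rightarrow> ereal) \<Rightarrow> 'a set" where
  "edom f = {x. f x < \<infinity>}"

definition proper :: "('a \<Rightarrow> ereal) \<Rightarrow> bool" where
  "proper f \<longleftrightarrow> edom f \<noteq> {}"

definition error_function :: "('a \<times> 'a \<Rightarrow> ereal) \<Rightarrow> bool" where
  "error_function e \<longleftrightarrow>
     (\<forall>x y. 0 \<le> e (x, y)) \<and> (\<forall>x y. e (x, y) = e (y, x)) \<and> edom e \<noteq> {}"

definition e_convex :: "('a::real_vector \<times> 'a \<Rightarrow> ereal) \<Rightarrow> ('a \<Rightarrow> ereal) \<Rightarrow> bool" where
  "e_convex e f \<longleftrightarrow>
     edom f \<times> edom f \<subseteq> edom e \<and>
     (\<forall>x y. \<forall>t\<in>{0<..<1::real}.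
        f (t *\<^sub>R x + (1 - t) *\<^sub>R y)
          \<le> ereal t * f x \<oplus> ereal (1 - t) * f y \<oplus> ereal (t * (1 - t)) * e (x, y))"

definition topological_dual :: "('a::hausdorff_lctvs \<Rightarrow> real) set" where
  "topological_dual = {l. linear l \<and> continuous_on UNIV l}"

definition e_subdifferential ::
  "('a::hausdorff_lctvs \<times> 'a \<Rightarrow> ereal) \<Rightarrow> ('a \<Rightarrow> ereal) \<Rightarrow> 'a \<Rightarrow> ('a \<Rightarrow> real) set" where
  "e_subdifferential e f x =
     (if x \<in> edom f
      then {l \<in> topological_dual. \<forall>y. ereal (l (y - x)) \<le> f y \<ominus> f x \<oplus> e (x, y)}
      else {})"

definition global_min_at :: "('a \<Rightarrow> ereal) \<Rightarrow> 'a \<Rightarrow> bool" where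
  "global_min_at h x \<longleftrightarrow> (\<forall>y. h x \<le> h y)"

end

theory Submission
  imports Defs
begin

text \<open>
  Since \<open>\<infinity> - \<infinity> = -\<infinity>\<close> here, a point with \<open>g y = \<infinity>\<close> would give \<open>f y - g y = -\<infinity>\<close>, below the
  finite minimum \<open>f x\<^sub>0 - g x\<^sub>0\<close>. Hence \<open>g\<close> is finite everywhere and minimality rearranges to
  \<open>g y - g x\<^sub>0 \<le> f y - f x\<^sub>0\<close> for all \<open>y\<close>.
\<close>

lemma lower_add_mono: "a \<le> b \<Longrightarrow> a \<oplus> c \<le> b \<oplus> c"
  by (auto simp: lower_add_def intro: add_right_mono)

text \<open>As \<open>a \<ominus> b\<close> is finite, \<open>d = \<infinity>\<close> would make the
  right side of the last premise -\<infinity>, a contradiction. If \<open>c = \<infinity>\<close>,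
  the right side of the conclusion is \<infinity>; otherwise all four values are real.\<close>

lemma lower_minus_le_swap:
  assumes "\<bar>a\<bar> \<noteq> \<infinity>" "\<bar>b\<bar> \<noteq> \<infinity>" "c \<noteq> -\<infinity>" "d \<noteq> -\<infinity>"
    and "a \<ominus> b \<le> c \<ominus> d"
  shows "d \<ominus> b \<le> c \<ominus> a"
  using assms unfolding lower_minus_def lower_add_def
  by (cases a; cases b; cases c; cases d) auto

theorem proposition17:
  fixes e :: "'a::hausdorff_lctvs \<times> 'a \<Rightarrow> ereal"
    and f g :: "'a \<Rightarrow> ereal"
    and x0 :: 'a
  assumes "error_function e"
    and "\<forall>x. f x \<noteq> -\<infinity>"
    and "\<forall>x. g x \<noteq> -\<infinity>"
    and "proper f" and "proper g"
    and "e_convex e f" and "e_convex e g"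
    and "x0 \<in> edom f \<inter> edom g"
    and "global_min_at (\<lambda>x. f x \<ominus> g x) x0"
  shows "e_subdifferential e g x0 \<subseteq> e_subdifferential e f x0"
proof -
  have fin: "\<bar>f x0\<bar> \<noteq> \<infinity>" "\<bar>g x0\<bar> \<noteq> \<infinity>"
    using assms(2,3,8) by (auto simp: edom_def)
  have "g y \<ominus> g x0 \<le> f y \<ominus> f x0" for y
    using lower_minus_le_swap[OF fin] assms(2,3,9) by (auto simp: global_min_at_def)
  \<comment> \<open>Monotonicity suffices, so \<open>e (x0, y)\<close> may be infinite.\<close>
  then have "g y \<ominus> g x0 \<oplus> e (x0, y) \<le> f y \<ominus> f x0 \<oplus> e (x0, y)" for y
    by (rule lower_add_mono)
  \<comment> \<open>\<open>x0 \<in> edom f\<close> rules out the empty branch for \<open>f\<close>;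
    each subgradient bound for \<open>g\<close> chains with the inequality above.\<close>
  then show ?thesis
    using assms(8) by (auto simp: e_subdifferential_def intro: order_trans)
qed

end
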